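(* Let $0<\alpha\le 1$, $0<p<1$ and $q=1-p$. Let $N$ be a renewal process whose inter-arrival time distribution is Mittag-Leffler, i.e. has Laplace transform $1/(1+s^{\alpha})$, $s\ge 0$. Let $N=N_1+N_2$ be the decomposition of $N$ determined by an indicator process $X(p)$ that is a Bernoulli$(p)$ process independent of $N$. Then $N_1$ and $N_2$ are also Mittag-Leffler renewal processes, up to a scale change; that is, each of $N_1$ and $N_2$ is a renewal process whose inter-arrival time has the distribution of $cT$ for some constant $c>0$ (depending on the process), where $T$ has Laplace transform $1/(1+s^{\alpha})$.
   Context: A renewal process is a point process on $(0,\infty)$ with points $t_1<t_2<\cdots$ such that $t_1,t_2-t_1,t_3-t_2,\dots$ are i.i.d. positive random variables (the inter-arrival times). Indicator process: if $t_1<t_2<\cdots$ are the points of $N=N_1+N_2$ (with $N_1,N_2$ having no common points), the indicator process is $X=\{X_1,X_2,\dots\}$, where $X_n=k$ iff $t_n$ is a point of $N_k$, $k=1,2$. Thus $N_1$ consists of the points $t_n$ with $X_n=1$ and $N_2$ of those with $X_n=2$. $X(p)$ being Bernoulli$(p)$ means that the $X_n$ are i.i.d. with $P(X_n=1)=p$ and $P(X_n=2)=q=1-p$. *)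

theory Defs
  imports "HOL-Probability.Probability"
begin

text \<open>
  A (simple) point process on the positive half-line is a random set of points
  \<open>N :: 'a \<Rightarrow> real set\<close> over the probability space \<open>M\<close>. Sequences are indexed
  from \<open>0\<close>, so \<open>t n\<close> and \<open>X n\<close> stand for the usual \<open>t\<^sub>n\<^sub>+\<^sub>1\<close> and \<open>X\<^sub>n\<^sub>+\<^sub>1\<close>.
  Properties of sample paths are required almost surely: a thinned process has only
  finitely many points on an event that is null but in general not empty.
\<close>

text \<open>
  The limit condition is the local finiteness of a point process. It holds
  automatically when the inter-arrival times are i.i.d. and positive.
\<close>

definition points_of :: "'a measure \<Rightarrow> ('a \<Rightarrow> real set) \<Rightarrow> (nat \<Rightarrow> 'a \<Rightarrow> real) \<Rightarrow> bool" where
  "points_of M N t \<longleftrightarrow>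
     (\<forall>n. t n \<in> borel_measurable M) \<and>
     (AE \<omega> in M. 0 < t 0 \<omega> \<and> strict_mono (\<lambda>n. t n \<omega>) \<and>
        filterlim (\<lambda>n. t n \<omega>) at_top sequentially \<and>
        N \<omega> = range (\<lambda>n. t n \<omega>))"

definition interarrival :: "(nat \<Rightarrow> 'a \<Rightarrow> real) \<Rightarrow> nat \<Rightarrow> 'a \<Rightarrow> real" where
  "interarrival t n \<omega> = (case n of 0 \<Rightarrow> t 0 \<omega> | Suc m \<Rightarrow> t (Suc m) \<omega> - t m \<omega>)"

text \<open>Almost sure positivity of the inter-arrival times is part of \<^const>\<open>points_of\<close>.\<close>

definition renewal_process :: "'a measure \<Rightarrow> real measure \<Rightarrow> ('a \<Rightarrow> real set) \<Rightarrow> bool" where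
  "renewal_process M \<mu> N \<longleftrightarrow>
     (\<exists>t. points_of M N t \<and>
          prob_space.indep_vars M (\<lambda>_. borel) (interarrival t) UNIV \<and>
          (\<forall>n. distr M borel (interarrival t n) = \<mu>))"

definition mittag_leffler :: "real \<Rightarrow> real measure \<Rightarrow> bool" where
  "mittag_leffler \<alpha> \<mu> \<longleftrightarrow>
     prob_space \<mu> \<and> sets \<mu> = sets borel \<and> (AE x in \<mu>. 0 < x) \<and>
     (\<forall>s\<ge>0. (\<integral>x. exp (- s * x) \<partial>\<mu>) = 1 / (1 + s powr \<alpha>))"

text \<open>
  \<open>N = N\<^sub>1 + N\<^sub>2\<close> without common points, and \<open>X\<close> is the indicator process of this
  decomposition, where \<open>t\<close> enumerates the points of \<open>N\<close>.
\<close>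

definition indicator_process ::
  "'a measure \<Rightarrow> (nat \<Rightarrow> 'a \<Rightarrow> real) \<Rightarrow> ('a \<Rightarrow> real set) \<Rightarrow> ('a \<Rightarrow> real set) \<Rightarrow>
   ('a \<Rightarrow> real set) \<Rightarrow> (nat \<Rightarrow> 'a \<Rightarrow> nat) \<Rightarrow> bool" where
  "indicator_process M t N N1 N2 X \<longleftrightarrow>
     points_of M N t \<and>
     (AE \<omega> in M. N \<omega> = N1 \<omega> \<union> N2 \<omega> \<and> N1 \<omega> \<inter> N2 \<omega> = {} \<and>
        (\<forall>n. (X n \<omega> = 1 \<longleftrightarrow> t n \<omega> \<in> N1 \<omega>) \<and> (X n \<omega> = 2 \<longleftrightarrow> t n \<omega> \<in> N2 \<omega>)))"

definition bernoulli_process :: "'a measure \<Rightarrow> real \<Rightarrow> (nat \<Rightarrow> 'a \<Rightarrow> nat) \<Rightarrow> bool" where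
  "bernoulli_process M p X \<longleftrightarrow>
     prob_space.indep_vars M (\<lambda>_. count_space UNIV) X UNIV \<and>
     (\<forall>n. measure M {\<omega> \<in> space M. X n \<omega> = 1} = p \<and>
          measure M {\<omega> \<in> space M. X n \<omega> = 2} = 1 - p)"

text \<open>
  The library's \<^const>\<open>prob_space.indep_var\<close> needs both random elements to have the same
  type, so independence of the two sequences is stated for the sigma-algebras they generate.
\<close>

definition indep_sequences :: "'a measure \<Rightarrow> (nat \<Rightarrow> 'a \<Rightarrow> real) \<Rightarrow> (nat \<Rightarrow> 'a \<Rightarrow> nat) \<Rightarrow> bool" where
  "indep_sequences M t X \<longleftrightarrow>
     prob_space.indep_set M
       (sets (vimage_algebra (space M) (\<lambda>\<omega> n. t n \<omega>) (Pi\<^sub>M UNIV (\<lambda>_. borel))))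
       (sets (vimage_algebra (space M) (\<lambda>\<omega> n. X n \<omega>) (Pi\<^sub>M UNIV (\<lambda>_. count_space UNIV))))"

end

theory Submission
  imports Defs
begin

text \<open>
  Mark each inter-arrival time with the indicator of its right end point. The marked inter-arrival
  times are i.i.d.; a gap of the thinned process is the sum of those up to the first success, and
  the sequence after the first success is independent of that sum and distributed as the
  original sequence, so the gaps are i.i.d. If \<open>\<phi>\<close> is the Laplace transform of the inter-arrival
  times, the one of a gap is the geometric mixture \<open>p \<phi> / (1 - (1 - p) \<phi>)\<close>. For
  \<open>\<phi> = 1 / (1 + s\<^sup>\<alpha>)\<close> this is \<open>1 / (1 + s\<^sup>\<alpha> / p)\<close>, the Mittag-Leffler transform at
  \<open>p powr (- 1 / \<alpha>) * s\<close>.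
\<close>

section \<open>Marked sequences: first success, restart and gaps, path by path\<close>

text \<open>
  A sequence \<open>\<omega>\<close> lists the inter-arrival times of the original process, each with a mark telling
  whether the point that ends the interval is kept. If no point is kept, \<open>first_success\<close> has a junk
  value; this event is null.
\<close>

definition first_success :: "(nat \<Rightarrow> real \<times> bool) \<Rightarrow> nat" where
  "first_success \<omega> = (LEAST n. snd (\<omega> n))"

definition first_gap :: "(nat \<Rightarrow> real \<times> bool) \<Rightarrow> real" where
  "first_gap \<omega> = (\<Sum>i\<le>first_success \<omega>. fst (\<omega> i))"

definition after_success :: "(nat \<Rightarrow> real \<times> bool) \<Rightarrow> nat \<Rightarrow> real \<times> bool" where
  "after_success \<omega> = (\<lambda>n. \<omega> (n + Suc (first_success \<omega>)))"

definition gap :: "nat \<Rightarrow> (nat \<Rightarrow> real \<times> bool) \<Rightarrow> real" where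
  "gap k \<omega> = first_gap ((after_success ^^ k) \<omega>)"

lemma gap_0: "gap 0 = first_gap"
  by (simp add: gap_def fun_eq_iff)

lemma gap_Suc: "gap (Suc k) \<omega> = gap k (after_success \<omega>)"
  by (simp only: gap_def funpow_Suc_right o_apply)

lemma first_success_eqI:
  assumes "snd (\<omega> m)" and "\<And>i. i < m \<Longrightarrow> \<not> snd (\<omega> i)"
  shows "first_success \<omega> = m"
  unfolding first_success_def using assms by (intro Least_equality) (auto simp: not_less[symmetric])

lemma first_success_iff:
  assumes "\<exists>n. snd (\<omega> n)"
  shows "first_success \<omega> = m \<longleftrightarrow> snd (\<omega> m) \<and> (\<forall>i<m. \<not> snd (\<omega> i))"
  using assms first_success_eqI[of \<omega> m] unfolding first_success_def
  by (metis LeastI_ex not_less_Least)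

text \<open>Each restart drops the entries up to and including the next marked one, so repeated
  restarts walk through the enumeration of the marked indices. That enumeration counts from 0, hence
  \<open>Suc k\<close> restarts for index \<open>k\<close>. Infinitely many marks keep the junk
  values of \<open>first_success\<close> and \<open>enumerate\<close> out of the induction.\<close>

lemma funpow_after_success:
  assumes "infinite {n. snd (\<omega> n)}"
  shows "(after_success ^^ Suc k) \<omega> = (\<lambda>n. \<omega> (n + Suc (enumerate {n. snd (\<omega> n)} k)))"
proof (induction k)
  case 0
  show ?case by (simp add: after_success_def first_success_def enumerate_0)
next
  case (Suc k)
  define e where "e = enumerate {n. snd (\<omega> n)}"
  have e_Suc: "e (Suc k) = (LEAST s. snd (\<omega> s) \<and> e k < s)"
    using enumerate_Suc''[OF assms] by (simp add: e_def)
  \<comment> \<open>The entry at \<open>e k\<close> is discarded as well, so position 0 of the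
    shifted sequence is position \<open>Suc (e k)\<close> of \<open>\<omega>\<close>.\<close>
  have "first_success (\<lambda>n. \<omega> (n + Suc (e k))) + Suc (e k) = e (Suc k)"
  proof -
    have 1: "snd (\<omega> (e (Suc k)))" "e k < e (Suc k)"
      using enumerate_in_set[OF assms] enumerate_step[OF assms] by (auto simp: e_def)
    have 2: "\<not> snd (\<omega> s)" if "e k < s" "s < e (Suc k)" for s
      using not_less_Least[of s "\<lambda>s. snd (\<omega> s) \<and> e k < s"] that e_Suc by auto
    have "first_success (\<lambda>n. \<omega> (n + Suc (e k))) = e (Suc k) - Suc (e k)"
      using 1 by (intro first_success_eqI 2) auto
    with 1 show ?thesis by simp
  qed
  then have "after_success (\<lambda>n. \<omega> (n + Suc (e k))) = (\<lambda>n. \<omega> (n + Suc (e (Suc k))))"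
    unfolding after_success_def by (metis add.assoc add_Suc_right add_Suc)
  then show ?case
    using Suc by (simp add: e_def)
qed

text \<open>Consecutive gaps sum over adjacent blocks of indices, each ending at a marked one. When
  the first components are inter-arrival times, the right-hand side is the \<open>k\<close>-th kept
  point.\<close>

lemma sum_gap:
  assumes inf: "infinite {n. snd (\<omega> n)}"
  shows "(\<Sum>j\<le>k. gap j \<omega>) = (\<Sum>i\<le>enumerate {n. snd (\<omega> n)} k. fst (\<omega> i))"
proof (induction k)
  case 0
  show ?case by (simp add: gap_def first_gap_def first_success_def enumerate_0)
next
  case (Suc k)
  define e where "e = enumerate {n. snd (\<omega> n)}"
  have e: "snd (\<omega> (e (Suc k)))" "e k < e (Suc k)"
    using enumerate_in_set[OF inf] enumerate_step[OF inf] by (auto simp: e_def)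
  have eq: "(after_success ^^ Suc k) \<omega> = (\<lambda>n. \<omega> (n + Suc (e k)))"
    using funpow_after_success[OF inf] by (simp add: e_def)
  have "\<not> snd (\<omega> s)" if "e k < s" "s < e (Suc k)" for s
    using not_less_Least[of s "\<lambda>s. snd (\<omega> s) \<and> e k < s"] that enumerate_Suc''[OF inf, of k]
    by (auto simp: e_def)
  then have "first_success (\<lambda>n. \<omega> (n + Suc (e k))) = e (Suc k) - Suc (e k)"
    using e by (intro first_success_eqI) auto
  then have "gap (Suc k) \<omega> = (\<Sum>i\<le>e (Suc k) - Suc (e k). fst (\<omega> (i + Suc (e k))))"
    unfolding gap_def eq first_gap_def by simp
  also have "\<dots> = (\<Sum>i\<in>{Suc (e k)..e (Suc k)}. fst (\<omega> i))"
    using e by (intro sum.reindex_bij_witness[of _ "\<lambda>i. i - Suc (e k)" "\<lambda>i. i + Suc (e k)"]) auto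
  finally have "gap (Suc k) \<omega> = (\<Sum>i\<in>{Suc (e k)..e (Suc k)}. fst (\<omega> i))" .
  moreover have "{..e (Suc k)} = {..e k} \<union> {Suc (e k)..e (Suc k)}"
    using e by auto
  then have "(\<Sum>i\<le>e (Suc k). fst (\<omega> i)) = (\<Sum>i\<le>e k. fst (\<omega> i)) + (\<Sum>i\<in>{Suc (e k)..e (Suc k)}. fst (\<omega> i))"
    by (simp only:) (intro sum.union_disjoint, auto)
  ultimately show ?case
    using Suc by (simp add: e_def)
qed

text \<open>By strong induction: once the values before \<open>n\<close> agree, \<open>g n\<close>
  can only be some \<open>f k\<close> with \<open>k \<ge> n\<close>, so
  \<open>f n \<le> g n\<close>, and the converse is symmetric. This makes the enumeration of the
  points of a process unique.\<close>

lemma strict_mono_range_unique: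
  fixes f g :: "nat \<Rightarrow> 'a::linorder"
  assumes f: "strict_mono f" and g: "strict_mono g" and eq: "range f = range g"
  shows "f = g"
proof
  fix n show "f n = g n"
  proof (induction n rule: less_induct)
    case (less n)
    have *: "f' n \<le> g' n" if f': "strict_mono f'" and g': "strict_mono g'" and rng: "range f' = range g'"
      and IH: "\<And>m. m < n \<Longrightarrow> f' m = g' m" for f' g' :: "nat \<Rightarrow> 'a"
    proof -
      obtain k where k: "g' n = f' k" using rng by blast
      have "\<not> k < n"
        using IH[of k] k strict_monoD[OF g', of k n] by auto
      then show ?thesis
        using k strict_mono_mono[OF f'] by (simp add: monoD)
    qed
    show ?case
      using *[OF f g eq] *[OF g f] eq less by (intro antisym) auto
  qed
qed

section \<open>The canonical space of i.i.d. marked inter-arrival times\<close>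

lemma measurable_PiM_UNIV:
  assumes "\<And>n. (\<lambda>\<omega>. f \<omega> n) \<in> measurable N M"
  shows "f \<in> measurable N (\<Pi>\<^sub>M n\<in>UNIV. M)"
  using measurable_restrict[of UNIV "\<lambda>n \<omega>. f \<omega> n" N "\<lambda>_. M"] assms by (simp add: restrict_UNIV)

text \<open>\<open>D\<close> is the law of an inter-arrival time and \<open>p\<close> the
  probability of keeping a point. The second component of the decomposition is covered by the
  instance with \<open>1 - p\<close> for \<open>p\<close>.\<close>

locale bernoulli_thinning =
  fixes D :: "real measure" and p :: real
  assumes prob_D: "prob_space D" and sets_D [measurable_cong]: "sets D = sets borel"
    and p_pos: "0 < p" and p_less_1: "p < 1"

text \<open>The product measure \<open>S\<close> is the law of the whole marked sequence. The gaps
  are studied under \<open>S\<close>, and the results are carried to an arbitrary probability space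
  through image measures.\<close>

sublocale bernoulli_thinning \<subseteq> sequence_space "D \<Otimes>\<^sub>M measure_pmf (bernoulli_pmf p)"
proof -
  interpret D: prob_space D by (rule prob_D)
  interpret pair_prob_space D "measure_pmf (bernoulli_pmf p)" ..
  show "sequence_space (D \<Otimes>\<^sub>M measure_pmf (bernoulli_pmf p))" ..
qed

context bernoulli_thinning
begin

abbreviation "L \<equiv> D \<Otimes>\<^sub>M measure_pmf (bernoulli_pmf p)"

lemma measurable_first_success [measurable]: "first_success \<in> measurable S (count_space UNIV)"
  unfolding first_success_def by measurable

text \<open>The number of summands is random, but it takes countably many values and each fixed
  number gives a measurable sum.\<close>

lemma measurable_first_gap [measurable]: "first_gap \<in> borel_measurable S"
  unfolding first_gap_def
  by (rule measurable_compose_countable[where f="\<lambda>m \<omega>. \<Sum>i\<le>m. fst (\<omega> i)"]) measurable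

lemma measurable_shift [measurable]: "(\<lambda>\<omega> n. \<omega> (n + d)) \<in> measurable S S"
  by (rule measurable_PiM_UNIV) measurable

lemma measurable_after_success [measurable]: "after_success \<in> measurable S S"
  unfolding after_success_def
  by (rule measurable_compose_countable[where f="\<lambda>m \<omega> n. \<omega> (n + Suc m)"])
    (rule measurable_shift measurable_first_success)+

lemma measurable_gap [measurable]: "gap k \<in> borel_measurable S"
proof (induction k)
  case 0
  show ?case by (simp add: gap_0)
next
  case (Suc k)
  then have "(\<lambda>\<omega>. gap k (after_success \<omega>)) \<in> borel_measurable S" by measurable
  then show ?case by (simp add: gap_Suc[abs_def])
qed

text \<open>The event without any mark is an infinite product of copies of
  \<open>UNIV \<times> {False}\<close>. Its probability is the limit of the powers of
  \<open>1 - p\<close>, which is 0.\<close>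

lemma AE_success: "AE \<omega> in S. \<exists>n. snd (\<omega> n)"
proof -
  interpret D: prob_space D by (rule prob_D)
  have "measure L (UNIV \<times> {False}) = 1 - p"
  proof -
    have "emeasure L (space D \<times> {False}) = emeasure D (space D) * emeasure (measure_pmf (bernoulli_pmf p)) {False}"
      by (intro measure_pmf.emeasure_pair_measure_Times) auto
    also have "\<dots> = ennreal (1 - p)"
      using p_pos p_less_1 by (simp add: D.emeasure_space_1 emeasure_pmf_single)
    finally show ?thesis
      using p_less_1 sets_eq_imp_space_eq[OF sets_D] by (simp add: measure_def)
  qed
  moreover have F: "UNIV \<times> {False} \<in> sets L"
    using sets_eq_imp_space_eq[OF sets_D] by (intro pair_measureI) (auto simp: sets_D)
  ultimately have "(\<lambda>n. (1 - p) ^ Suc n) \<longlonglongrightarrow> measure S (Pi UNIV (\<lambda>_. UNIV \<times> {False}))"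
    using measure_PiM_countable[of "\<lambda>_. UNIV \<times> {False}"] by simp
  moreover have "(\<lambda>n. (1 - p) ^ Suc n) \<longlonglongrightarrow> 0"
    using p_pos p_less_1 by (intro LIMSEQ_Suc LIMSEQ_power_zero) auto
  ultimately have "measure S (Pi UNIV (\<lambda>_. UNIV \<times> {False})) = 0"
    using LIMSEQ_unique by blast
  then have "Pi UNIV (\<lambda>_. UNIV \<times> {False}) \<in> null_sets S"
    using infprod_in_sets[OF F] by (simp add: null_sets_def P.emeasure_eq_measure)
  then show ?thesis
    by (rule AE_I') (auto simp: Pi_iff mem_Times_iff)
qed

text \<open>An i.i.d. law is invariant under shifts, so almost surely a success follows after each
  of the countably many indices; the set of marked indices is then unbounded.\<close>

lemma AE_infinite_success: "AE \<omega> in S. infinite {n. snd (\<omega> n)}"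
proof -
  have "AE \<omega> in S. \<exists>n. snd (\<omega> (n + d))" for d
  proof -
    have eq: "distr S S (\<lambda>\<omega> n. \<omega> (n + d)) = S"
      using distr_PiM_reindex[of UNIV "\<lambda>_. L" "\<lambda>n. n + d" UNIV] M.prob_space_axioms
      by (simp add: inj_on_def restrict_UNIV)
    show ?thesis
      by (rule AE_distrD[OF measurable_shift]) (simp only: eq AE_success)
  qed
  then have "AE \<omega> in S. \<forall>d. \<exists>n. snd (\<omega> (n + d))"
    by (simp add: AE_all_countable)
  then show ?thesis
  proof eventually_elim
    case (elim \<omega>)
    then show ?case
      unfolding infinite_nat_iff_unbounded_le by (metis le_add2 mem_Collect_eq)
  qed
qed

section \<open>Regeneration at the first success and independence of the gaps\<close>

text \<open>Split by the index \<open>m\<close> of the first success. With \<open>m\<close> fixed,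
  the first gap depends on the entries up to \<open>m\<close> and the restarted sequence on those
  after \<open>m\<close>, so every term factors, and the factor of the tail does not depend on
  \<open>m\<close>. The restarted sequence therefore has law \<open>S\<close> again.\<close>

lemma first_gap_after_success_indep:
  assumes A [measurable]: "A \<in> sets borel" and B [measurable]: "B \<in> sets S"
  shows "emeasure S {\<omega>\<in>space S. first_gap \<omega> \<in> A \<and> after_success \<omega> \<in> B} =
    emeasure S {\<omega>\<in>space S. first_gap \<omega> \<in> A} * emeasure S B"
proof -
  \<comment> \<open>With the first success pinned at \<open>m\<close>, the random sum becomes one of
    fixed length, and the event involves only the entries 0 to \<open>m\<close>.\<close>
  define E where "E m = {\<omega>\<in>space S. snd (\<omega> m) \<and> (\<forall>i<m. \<not> snd (\<omega> i)) \<and> (\<Sum>i\<le>m. fst (\<omega> i)) \<in> A}" for m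
  have E [measurable]: "E m \<in> sets S" for m
    unfolding E_def by measurable
  have split: "emeasure S {\<omega>\<in>space S. first_gap \<omega> \<in> A \<and> after_success \<omega> \<in> C} = (\<Sum>m. emeasure S (E m) * emeasure S C)"
    if C [measurable]: "C \<in> sets S" for C
  proof -
    define F where "F m = {\<omega>\<in>E m. (\<lambda>n. \<omega> (n + Suc m)) \<in> C}" for m
    have F_eq: "F m = {\<omega>\<in>space S. \<omega> \<in> E m \<and> (\<lambda>n. \<omega> (n + Suc m)) \<in> C}" for m
      by (auto simp: F_def E_def)
    have F [measurable]: "F m \<in> sets S" for m
      unfolding F_eq by (intro sets.sets_Collect_conj measurable_sets_Collect[OF measurable_shift]) simp_all
    \<comment> \<open>On sequences without a mark \<open>first_success\<close> is junk and no
      \<open>F m\<close> applies, so the two events agree only almost surely.\<close>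
    have "emeasure S {\<omega>\<in>space S. first_gap \<omega> \<in> A \<and> after_success \<omega> \<in> C} = emeasure S (\<Union>m. F m)"
    proof (rule emeasure_eq_AE)
      show "AE \<omega> in S. \<omega> \<in> {\<omega>\<in>space S. first_gap \<omega> \<in> A \<and> after_success \<omega> \<in> C} \<longleftrightarrow> \<omega> \<in> (\<Union>m. F m)"
        using AE_success AE_space
      proof eventually_elim
        case (elim \<omega>)
        have "\<omega> \<in> F m \<longleftrightarrow> first_success \<omega> = m \<and> first_gap \<omega> \<in> A \<and> after_success \<omega> \<in> C" for m
          using elim(2) first_success_iff[OF elim(1), of m]
          by (cases "first_success \<omega> = m") (auto simp: F_def E_def first_gap_def after_success_def)
        then show ?case
          using elim(2) by simp
      qed
    qed measurable
    also have "\<dots> = (\<Sum>m. emeasure S (F m))"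
    proof (rule suminf_emeasure[symmetric])
      show "disjoint_family F"
        unfolding disjoint_family_on_def F_def E_def by (auto) (metis linorder_neqE_nat)
    qed auto
    also have "\<dots> = (\<Sum>m. emeasure S (E m) * emeasure S C)"
    proof (rule suminf_cong)
      fix m
      \<comment> \<open>Gluing the first \<open>Suc m\<close> entries of \<open>\<omega>\<close> to
        an independent \<open>\<omega>'\<close> again gives law \<open>S\<close>. Membership in
        \<open>E m\<close> then concerns \<open>\<omega>\<close> alone and the shifted sequence is
        exactly \<open>\<omega>'\<close>, so \<open>F m\<close> pulls back to a rectangle.\<close>
      have "emeasure S (F m) = emeasure (distr (S \<Otimes>\<^sub>M S) S (\<lambda>(\<omega>, \<omega>'). comb_seq (Suc m) \<omega> \<omega>')) (F m)"
        by (simp only: PiM_comb_seq)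
      also have "\<dots> = emeasure (S \<Otimes>\<^sub>M S) ((\<lambda>(\<omega>, \<omega>'). comb_seq (Suc m) \<omega> \<omega>') -` F m \<inter> space (S \<Otimes>\<^sub>M S))"
        by (intro emeasure_distr) auto
      also have "(\<lambda>(\<omega>, \<omega>'). comb_seq (Suc m) \<omega> \<omega>') -` F m \<inter> space (S \<Otimes>\<^sub>M S) = E m \<times> C"
      proof -
        have "comb_seq (Suc m) \<omega> \<omega>' \<in> F m \<longleftrightarrow> \<omega> \<in> E m \<and> \<omega>' \<in> C"
          if "\<omega> \<in> space S" "\<omega>' \<in> space S" for \<omega> \<omega>'
        proof -
          have "comb_seq (Suc m) \<omega> \<omega>' \<in> space S"
            using measurable_space[OF measurable_comb_seq, of "(\<omega>, \<omega>')" L "Suc m"] that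
            by (simp add: space_pair_measure)
          then show ?thesis
            using that by (simp add: F_def E_def comb_seq_def)
        qed
        moreover have "E m \<subseteq> space S" "C \<subseteq> space S"
          by (rule sets.sets_into_space, simp)+
        ultimately show ?thesis
          by (auto simp: space_pair_measure subset_iff)
      qed
      also have "emeasure (S \<Otimes>\<^sub>M S) (E m \<times> C) = emeasure S (E m) * emeasure S C"
        by (intro P.emeasure_pair_measure_Times) auto
      finally show "emeasure S (F m) = emeasure S (E m) * emeasure S C" .
    qed
    finally show ?thesis .
  qed
  \<comment> \<open>Taking the whole space for \<open>C\<close>, with probability 1, identifies the
    sum over \<open>E m\<close> with the law of the first gap.\<close>
  have "emeasure S {\<omega>\<in>space S. first_gap \<omega> \<in> A} = (\<Sum>m. emeasure S (E m))"
  proof -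
    have "{\<omega>\<in>space S. first_gap \<omega> \<in> A} = {\<omega>\<in>space S. first_gap \<omega> \<in> A \<and> after_success \<omega> \<in> space S}"
      using measurable_space[OF measurable_after_success] by auto
    then show ?thesis
      using split[OF sets.top] by (simp add: P.emeasure_space_1)
  qed
  then show ?thesis
    by (simp add: split[OF B])
qed

text \<open>Induction on \<open>n\<close>: the later gaps are the gaps of the restarted sequence,
  which is independent of the first gap and has law \<open>S\<close>. The sets \<open>A\<close> are
  generalized because they shift by one index.\<close>

lemma emeasure_gaps:
  fixes A :: "nat \<Rightarrow> real set"
  assumes "\<And>k. A k \<in> sets borel"
  shows "emeasure S {\<omega>\<in>space S. \<forall>k<n. gap k \<omega> \<in> A k} = (\<Prod>k<n. emeasure (distr S borel first_gap) (A k))"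
  using assms
proof (induction n arbitrary: A)
  case 0
  show ?case by (simp add: P.emeasure_space_1)
next
  case (Suc n)
  note A [measurable] = Suc.prems
  define B where "B = {\<omega>\<in>space S. \<forall>k<n. gap k \<omega> \<in> A (Suc k)}"
  have [measurable]: "B \<in> sets S"
    unfolding B_def by measurable
  have "{\<omega>\<in>space S. \<forall>k<Suc n. gap k \<omega> \<in> A k} = {\<omega>\<in>space S. first_gap \<omega> \<in> A 0 \<and> after_success \<omega> \<in> B}"
    using measurable_space[OF measurable_after_success]
    by (auto simp: B_def All_less_Suc2 gap_0 gap_Suc)
  then have "emeasure S {\<omega>\<in>space S. \<forall>k<Suc n. gap k \<omega> \<in> A k} =
      emeasure S {\<omega>\<in>space S. first_gap \<omega> \<in> A 0} * emeasure S B"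
    by (simp add: first_gap_after_success_indep)
  also have "emeasure S {\<omega>\<in>space S. first_gap \<omega> \<in> A 0} = emeasure (distr S borel first_gap) (A 0)"
    by (subst emeasure_distr) (auto intro!: arg_cong[where f="emeasure S"])
  also have "emeasure S B = (\<Prod>k<n. emeasure (distr S borel first_gap) (A (Suc k)))"
    unfolding B_def by (rule Suc.IH) auto
  finally show ?case
    by (simp add: prod.lessThan_Suc_shift del: prod.lessThan_Suc)
qed

text \<open>A product measure is determined by its cylinder sets, and \<open>emeasure_gaps\<close>
  evaluates those over initial segments of indices.\<close>

lemma distr_gaps:
  "distr S (\<Pi>\<^sub>M k\<in>UNIV. borel) (\<lambda>\<omega> k. gap k \<omega>) = (\<Pi>\<^sub>M k\<in>(UNIV::nat set). distr S borel first_gap)"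
proof -
  interpret gap_law: prob_space "distr S borel first_gap"
    by (rule P.prob_space_distr) measurable
  interpret G: sequence_space "distr S borel first_gap" ..
  show ?thesis
  proof (rule G.PiM_eq)
    show "sets (distr S (\<Pi>\<^sub>M k\<in>UNIV. borel) (\<lambda>\<omega> k. gap k \<omega>)) = sets G.S"
      by (simp cong: sets_PiM_cong)
    fix J :: "nat set" and A :: "nat \<Rightarrow> real set"
    assume J: "finite J" and A: "\<And>j. j \<in> J \<Longrightarrow> A j \<in> sets (distr S borel first_gap)"
    \<comment> \<open>Padding with \<open>UNIV\<close> turns a cylinder over \<open>J\<close> into
      one over the indices below \<open>n\<close>; the added factors equal 1. Inserting 0 gives
      \<open>Max\<close> a nonempty set even for empty \<open>J\<close>.\<close>
    define A' where "A' k = (if k \<in> J then A k else UNIV)" for k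
    define n where "n = Suc (Max (insert 0 J))"
    have n: "j < n" if "j \<in> J" for j
      using J that by (auto simp: n_def less_Suc_eq_le)
    have emb: "prod_emb UNIV (\<lambda>_. distr S borel first_gap) J (\<Pi>\<^sub>E j\<in>J. A j) = {x. \<forall>j<n. x j \<in> A' j}"
      using n by (auto simp: prod_emb_def space_PiM A'_def PiE_iff)
    have [measurable]: "A' k \<in> sets borel" for k
      using A by (auto simp: A'_def)
    have "emeasure (distr S (\<Pi>\<^sub>M k\<in>UNIV. borel) (\<lambda>\<omega> k. gap k \<omega>)) {x. \<forall>j<n. x j \<in> A' j} =
       emeasure S {\<omega>\<in>space S. \<forall>k<n. gap k \<omega> \<in> A' k}"
    proof (subst emeasure_distr)
      have "{x\<in>space (\<Pi>\<^sub>M k\<in>UNIV. borel). \<forall>j<n. x j \<in> A' j} \<in> sets (\<Pi>\<^sub>M k\<in>(UNIV::nat set). borel)"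
        by measurable
      then show "{x. \<forall>j<n. x j \<in> A' j} \<in> sets (\<Pi>\<^sub>M k\<in>(UNIV::nat set). borel)"
        by (simp add: space_PiM)
    qed (auto intro!: arg_cong[where f="emeasure S"] measurable_PiM_UNIV)
    also have "\<dots> = (\<Prod>k<n. emeasure (distr S borel first_gap) (A' k))"
      by (rule emeasure_gaps) simp
    also have "\<dots> = (\<Prod>k\<in>J. emeasure (distr S borel first_gap) (A k))"
      using n J gap_law.emeasure_space_1
      by (intro prod.mono_neutral_cong_right) (auto simp: A'_def)
    finally show "emeasure (distr S (\<Pi>\<^sub>M k\<in>UNIV. borel) (\<lambda>\<omega> k. gap k \<omega>))
        (prod_emb UNIV (\<lambda>_. distr S borel first_gap) J (\<Pi>\<^sub>E j\<in>J. A j)) =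
      (\<Prod>k\<in>J. emeasure (distr S borel first_gap) (A k))"
      by (simp only: emb)
  qed
qed

section \<open>Positivity and Laplace transform of a gap\<close>

lemma AE_first_gap_pos:
  assumes "AE x in D. 0 < x"
  shows "AE \<omega> in S. 0 < first_gap \<omega>"
proof -
  interpret D: prob_space D by (rule prob_D)
  interpret DB: pair_prob_space D "measure_pmf (bernoulli_pmf p)" ..
  have "AE z in L. 0 < fst z"
    using assms by (intro DB.AE_pair_measure) auto
  then have "AE \<omega> in S. 0 < fst (\<omega> n)" for n
    using AE_PiM_component[of UNIV "\<lambda>_. L" n] M.prob_space_axioms by simp
  then have "AE \<omega> in S. \<forall>n. 0 < fst (\<omega> n)"
    by (simp add: AE_all_countable)
  then show ?thesis
    by eventually_elim (auto simp: first_gap_def intro!: sum_pos)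
qed

lemma laplace_first_gap:
  assumes pos: "AE x in D. 0 < x" and s: "0 \<le> s"
    and laplace: "(\<integral>x. exp (- s * x) \<partial>D) = \<phi>"
  shows "(\<integral>\<omega>. exp (- s * first_gap \<omega>) \<partial>S) = p * \<phi> / (1 - (1 - p) * \<phi>)"
proof -
  interpret D: prob_space D by (rule prob_D)
  txt \<open>
    Conditioning on the first entry of the sequence gives \<open>\<psi> = \<phi> (p + (1 - p) \<psi>)\<close>.
  \<close>
  define \<psi> where "\<psi> = (\<integral>\<^sup>+\<omega>. ennreal (exp (- s * first_gap \<omega>)) \<partial>S)"
  have int_D: "integrable D (\<lambda>x. exp (- s * x))"
    using pos s by (intro D.integrable_const_bound[of _ 1]) (auto simp: mult_nonneg_nonneg)
  have \<phi>: "(\<integral>\<^sup>+x. ennreal (exp (- s * x)) \<partial>D) = ennreal \<phi>"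
    using nn_integral_eq_integral[OF int_D] laplace by simp
  have \<phi>_nonneg: "0 \<le> \<phi>" and \<phi>_le_1: "\<phi> \<le> 1"
  proof -
    show "0 \<le> \<phi>" unfolding laplace[symmetric] by simp
    have "\<phi> \<le> (\<integral>x. 1 \<partial>D)"
      unfolding laplace[symmetric] using pos s int_D
      by (intro integral_mono_AE) (auto simp: mult_nonneg_nonneg)
    then show "\<phi> \<le> 1" by (simp add: D.prob_space)
  qed
  \<comment> \<open>A kept first entry ends the gap at once; otherwise it is added to the first gap
    of the tail, which needs a success in the tail.\<close>
  have step: "first_gap (case_nat z \<omega>) = fst z + (if snd z then 0 else first_gap \<omega>)"
    if "\<exists>n. snd (\<omega> n)" for z and \<omega> :: "nat \<Rightarrow> real \<times> bool"
  proof (cases "snd z")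
    case True
    then have "first_success (case_nat z \<omega>) = 0"
      by (intro first_success_eqI) auto
    with True show ?thesis by (simp add: first_gap_def)
  next
    case False
    have "first_success (case_nat z \<omega>) = Suc (first_success \<omega>)"
      using False first_success_iff[OF that, of "first_success \<omega>"]
      by (intro first_success_eqI) (auto split: nat.split)
    with False show ?thesis
      by (simp add: first_gap_def sum.atMost_Suc_shift del: sum.atMost_Suc)
  qed
  \<comment> \<open>The first entry and the tail are independent with laws \<open>L\<close> and
    \<open>S\<close>, so the integral over the tail can be carried out first.\<close>
  have "\<psi> = (\<integral>\<^sup>+\<omega>. ennreal (exp (- s * first_gap \<omega>)) \<partial>distr (L \<Otimes>\<^sub>M S) S (\<lambda>(z, \<omega>). case_nat z \<omega>))"
    by (simp only: PiM_iter \<psi>_def)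
  also have "\<dots> = (\<integral>\<^sup>+x. ennreal (exp (- s * first_gap (case_nat (fst x) (snd x)))) \<partial>(L \<Otimes>\<^sub>M S))"
    by (subst nn_integral_distr) (auto simp: split_beta')
  also have "\<dots> = (\<integral>\<^sup>+z. \<integral>\<^sup>+\<omega>. ennreal (exp (- s * first_gap (case_nat z \<omega>))) \<partial>S \<partial>L)"
    by (subst P.nn_integral_fst[symmetric]) auto
  also have "\<dots> = (\<integral>\<^sup>+z. ennreal (exp (- s * fst z)) * (if snd z then 1 else \<psi>) \<partial>L)"
  proof (rule nn_integral_cong)
    fix z
    have "(\<integral>\<^sup>+\<omega>. ennreal (exp (- s * first_gap (case_nat z \<omega>))) \<partial>S) =
       (\<integral>\<^sup>+\<omega>. ennreal (exp (- s * fst z)) * (if snd z then 1 else ennreal (exp (- s * first_gap \<omega>))) \<partial>S)"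
    proof (rule nn_integral_cong_AE)
      show "AE \<omega> in S. ennreal (exp (- s * first_gap (case_nat z \<omega>))) =
        ennreal (exp (- s * fst z)) * (if snd z then 1 else ennreal (exp (- s * first_gap \<omega>)))"
        using AE_success
      proof eventually_elim
        case (elim \<omega>)
        show ?case
          unfolding step[OF elim]
          by (simp add: ennreal_mult[symmetric] exp_add[symmetric] algebra_simps)
      qed
    qed
    also have "\<dots> = ennreal (exp (- s * fst z)) * (if snd z then 1 else \<psi>)"
      by (cases "snd z") (simp_all add: P.emeasure_space_1 nn_integral_cmult \<psi>_def)
    finally show "(\<integral>\<^sup>+\<omega>. ennreal (exp (- s * first_gap (case_nat z \<omega>))) \<partial>S) =
       ennreal (exp (- s * fst z)) * (if snd z then 1 else \<psi>)" .
  qed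
  also have "\<dots> = (\<integral>\<^sup>+x. \<integral>\<^sup>+b. ennreal (exp (- s * x)) * (if b then 1 else \<psi>) \<partial>measure_pmf (bernoulli_pmf p) \<partial>D)"
    by (subst measure_pmf.nn_integral_fst[symmetric]) auto
  also have "\<dots> = (\<integral>\<^sup>+x. ennreal (exp (- s * x)) * (ennreal p + \<psi> * ennreal (1 - p)) \<partial>D)"
    using p_pos p_less_1 by (simp add: nn_integral_cmult)
  also have "\<dots> = ennreal \<phi> * (ennreal p + \<psi> * ennreal (1 - p))"
    by (subst nn_integral_multc) (measurable, simp only: \<phi>)
  finally have eq: "\<psi> = ennreal \<phi> * (ennreal p + \<psi> * ennreal (1 - p))" .
  \<comment> \<open>For positive \<open>\<phi>\<close> infinity also solves the equation in the
    extended reals. The integrand is almost surely at most 1, so \<open>\<psi>\<close> is a real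
    number \<open>r\<close> and the linear equation can be solved.\<close>
  have gap_nonneg: "AE \<omega> in S. 0 \<le> first_gap \<omega>"
    using AE_first_gap_pos[OF pos] by eventually_elim simp
  have int: "integrable S (\<lambda>\<omega>. exp (- s * first_gap \<omega>))"
    using gap_nonneg s by (intro P.integrable_const_bound[of _ 1]) (auto simp: mult_nonneg_nonneg)
  define r where "r = (\<integral>\<omega>. exp (- s * first_gap \<omega>) \<partial>S)"
  have r: "\<psi> = ennreal r" "0 \<le> r"
    unfolding \<psi>_def r_def by (subst nn_integral_eq_integral[OF int]) auto
  have "ennreal r = ennreal (\<phi> * (p + r * (1 - p)))"
    using eq p_pos p_less_1 r \<phi>_nonneg
    by (simp add: r ennreal_mult'' ennreal_plus mult_nonneg_nonneg)
  then have "r = \<phi> * (p + r * (1 - p))"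
    using r p_pos p_less_1 \<phi>_nonneg by (subst (asm) ennreal_inj) (auto intro!: mult_nonneg_nonneg add_nonneg_nonneg)
  moreover have "(1 - p) * \<phi> \<le> (1 - p) * 1"
    using \<phi>_le_1 p_less_1 by (intro mult_left_mono) auto
  then have "(1 - p) * \<phi> < 1"
    using p_pos by simp
  ultimately show ?thesis
    unfolding r_def[symmetric] by (simp add: field_simps)
qed

end

section \<open>Pairing two independent sequences of independent variables\<close>

text \<open>Rectangles form an intersection-stable generator of the product sigma-algebra. On
  rectangles the probability factors first between the two sequences, by \<open>YX\<close> applied
  to cylinder sets, and then within each sequence.\<close>

lemma (in prob_space)
  assumes Y: "indep_vars (\<lambda>_. N) Y UNIV" and X: "indep_vars (\<lambda>_. K) X UNIV"
    and YX: "\<And>A B. A \<in> sets (\<Pi>\<^sub>M i\<in>UNIV. N) \<Longrightarrow> B \<in> sets (\<Pi>\<^sub>M i\<in>UNIV. K) \<Longrightarrow>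
      prob {\<omega>\<in>space M. (\<lambda>i. Y i \<omega>) \<in> A \<and> (\<lambda>i. X i \<omega>) \<in> B} =
      prob {\<omega>\<in>space M. (\<lambda>i. Y i \<omega>) \<in> A} * prob {\<omega>\<in>space M. (\<lambda>i. X i \<omega>) \<in> B}"
  shows indep_vars_Pair: "indep_vars (\<lambda>_. N \<Otimes>\<^sub>M K) (\<lambda>i \<omega>. (Y i \<omega>, X i \<omega>)) UNIV"
    and distr_Pair_eq: "distr M (N \<Otimes>\<^sub>M K) (\<lambda>\<omega>. (Y i \<omega>, X i \<omega>)) = distr M N (Y i) \<Otimes>\<^sub>M distr M K (X i)"
proof -
  have Y_meas [measurable]: "Y i \<in> measurable M N" for i
    using Y by (auto simp: indep_vars_def)
  have X_meas [measurable]: "X i \<in> measurable M K" for i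
    using X by (auto simp: indep_vars_def)
  have rect: "prob (\<Inter>j\<in>J. (\<lambda>\<omega>. (Y j \<omega>, X j \<omega>)) -` (A j \<times> B j) \<inter> space M) =
      (\<Prod>j\<in>J. prob (Y j -` A j \<inter> space M) * prob (X j -` B j \<inter> space M))"
    if J: "finite J" "J \<noteq> {}" and A: "\<And>j. j \<in> J \<Longrightarrow> A j \<in> sets N" and B: "\<And>j. j \<in> J \<Longrightarrow> B j \<in> sets K" for J A B
  proof -
    let ?A = "prod_emb UNIV (\<lambda>_. N) J (\<Pi>\<^sub>E j\<in>J. A j)"
    let ?B = "prod_emb UNIV (\<lambda>_. K) J (\<Pi>\<^sub>E j\<in>J. B j)"
    have Y_emb: "{\<omega>\<in>space M. (\<lambda>i. Y i \<omega>) \<in> ?A} = (\<Inter>j\<in>J. Y j -` A j \<inter> space M)"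
      using J measurable_space[OF Y_meas] by (auto simp: prod_emb_def space_PiM)
    have X_emb: "{\<omega>\<in>space M. (\<lambda>i. X i \<omega>) \<in> ?B} = (\<Inter>j\<in>J. X j -` B j \<inter> space M)"
      using J measurable_space[OF X_meas] by (auto simp: prod_emb_def space_PiM)
    have "(\<Inter>j\<in>J. (\<lambda>\<omega>. (Y j \<omega>, X j \<omega>)) -` (A j \<times> B j) \<inter> space M) =
        (\<Inter>j\<in>J. Y j -` A j \<inter> space M) \<inter> (\<Inter>j\<in>J. X j -` B j \<inter> space M)"
      using J by auto
    also have "\<dots> = {\<omega>\<in>space M. (\<lambda>i. Y i \<omega>) \<in> ?A \<and> (\<lambda>i. X i \<omega>) \<in> ?B}"
      unfolding Y_emb[symmetric] X_emb[symmetric] by blast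
    also have "prob \<dots> = prob (\<Inter>j\<in>J. Y j -` A j \<inter> space M) * prob (\<Inter>j\<in>J. X j -` B j \<inter> space M)"
      unfolding Y_emb[symmetric] X_emb[symmetric] using J A B
      by (intro YX sets_PiM_I) auto
    also have "\<dots> = (\<Prod>j\<in>J. prob (Y j -` A j \<inter> space M)) * (\<Prod>j\<in>J. prob (X j -` B j \<inter> space M))"
      using J A B by (intro arg_cong2[where f="(*)"] indep_varsD[OF Y] indep_varsD[OF X]) auto
    finally show ?thesis by (simp add: prod.distrib)
  qed
  \<comment> \<open>The case of a single index supplies the factors needed for the independence of
    the pairs and also the product form of the law of one pair.\<close>
  have rect1: "prob ((\<lambda>\<omega>. (Y j \<omega>, X j \<omega>)) -` (A \<times> B) \<inter> space M) = prob (Y j -` A \<inter> space M) * prob (X j -` B \<inter> space M)"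
    if "A \<in> sets N" "B \<in> sets K" for j A B
    using rect[of "{j}" "\<lambda>_. A" "\<lambda>_. B"] that by simp
  have "indep_vars (\<lambda>_. N \<Otimes>\<^sub>M K) (\<lambda>i \<omega>. (Y i \<omega>, X i \<omega>)) J" if J: "finite J" "J \<noteq> {}" for J
  proof (subst indep_vars_finite[where E="\<lambda>_. {a \<times> b | a b. a \<in> sets N \<and> b \<in> sets K}"])
    show "\<forall>C\<in>J \<rightarrow> {a \<times> b | a b. a \<in> sets N \<and> b \<in> sets K}.
      prob (\<Inter>j\<in>J. (\<lambda>\<omega>. (Y j \<omega>, X j \<omega>)) -` C j \<inter> space M) =
      (\<Prod>j\<in>J. prob ((\<lambda>\<omega>. (Y j \<omega>, X j \<omega>)) -` C j \<inter> space M))"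
    proof
      fix C assume "C \<in> J \<rightarrow> {a \<times> b | a b. a \<in> sets N \<and> b \<in> sets K}"
      then have "\<forall>j\<in>J. \<exists>a b. C j = a \<times> b \<and> a \<in> sets N \<and> b \<in> sets K"
        by blast
      then obtain A B where AB: "\<And>j. j \<in> J \<Longrightarrow> C j = A j \<times> B j \<and> A j \<in> sets N \<and> B j \<in> sets K"
        by metis
      have "prob (\<Inter>j\<in>J. (\<lambda>\<omega>. (Y j \<omega>, X j \<omega>)) -` C j \<inter> space M) =
          prob (\<Inter>j\<in>J. (\<lambda>\<omega>. (Y j \<omega>, X j \<omega>)) -` (A j \<times> B j) \<inter> space M)"
        using AB by (intro arg_cong[where f=prob] INF_cong) auto
      also have "\<dots> = (\<Prod>j\<in>J. prob (Y j -` A j \<inter> space M) * prob (X j -` B j \<inter> space M))"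
        using J AB by (intro rect) auto
      also have "\<dots> = (\<Prod>j\<in>J. prob ((\<lambda>\<omega>. (Y j \<omega>, X j \<omega>)) -` C j \<inter> space M))"
        using AB by (intro prod.cong) (auto simp: rect1)
      finally show "prob (\<Inter>j\<in>J. (\<lambda>\<omega>. (Y j \<omega>, X j \<omega>)) -` C j \<inter> space M) =
        (\<Prod>j\<in>J. prob ((\<lambda>\<omega>. (Y j \<omega>, X j \<omega>)) -` C j \<inter> space M))" .
    qed
    show "{a \<times> b |a b. a \<in> sets N \<and> b \<in> sets K} \<subseteq> Pow (space (N \<Otimes>\<^sub>M K))"
      using pair_measure_closed[of N K] by (simp add: space_pair_measure)
  qed (use J in \<open>auto simp: sets_pair_measure space_pair_measure intro: Int_stable_pair_measure_generator\<close>)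
  then show "indep_vars (\<lambda>_. N \<Otimes>\<^sub>M K) (\<lambda>i \<omega>. (Y i \<omega>, X i \<omega>)) UNIV"
    unfolding indep_vars_def2 by (subst indep_sets_finite_index_sets) auto
  interpret Yd: prob_space "distr M N (Y i)" by (rule prob_space_distr) simp
  interpret Xd: prob_space "distr M K (X i)" by (rule prob_space_distr) simp
  show "distr M (N \<Otimes>\<^sub>M K) (\<lambda>\<omega>. (Y i \<omega>, X i \<omega>)) = distr M N (Y i) \<Otimes>\<^sub>M distr M K (X i)"
  proof (rule pair_measure_eqI[symmetric])
    show "sets (distr M N (Y i) \<Otimes>\<^sub>M distr M K (X i)) = sets (distr M (N \<Otimes>\<^sub>M K) (\<lambda>\<omega>. (Y i \<omega>, X i \<omega>)))"
      by (simp cong: sets_pair_measure_cong)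
    fix A B assume "A \<in> sets (distr M N (Y i))" "B \<in> sets (distr M K (X i))"
    then show "emeasure (distr M N (Y i)) A * emeasure (distr M K (X i)) B =
        emeasure (distr M (N \<Otimes>\<^sub>M K) (\<lambda>\<omega>. (Y i \<omega>, X i \<omega>))) (A \<times> B)"
      by (simp add: emeasure_distr emeasure_eq_measure rect1 ennreal_mult)
  qed (unfold_locales)
qed

section \<open>Enumerations of points, inter-arrival times and almost sure modifications\<close>

text \<open>\<open>renewal_process\<close> only asserts that some enumeration has i.i.d.
  inter-arrival times. This allows passing to the enumeration \<open>t\<close> to which the
  indicator process refers.\<close>

lemma AE_points_of_unique:
  assumes "points_of M N t" and "points_of M N t'"
  shows "AE \<omega> in M. \<forall>n. t n \<omega> = t' n \<omega>"
proof -
  have "AE \<omega> in M. strict_mono (\<lambda>n. t n \<omega>) \<and> strict_mono (\<lambda>n. t' n \<omega>) \<and>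
      range (\<lambda>n. t n \<omega>) = range (\<lambda>n. t' n \<omega>)"
    using assms unfolding points_of_def by (auto elim: eventually_elim2)
  then show ?thesis
  proof eventually_elim
    case (elim \<omega>)
    then have "(\<lambda>n. t n \<omega>) = (\<lambda>n. t' n \<omega>)"
      by (intro strict_mono_range_unique) auto
    then show ?case by metis
  qed
qed

lemma sum_interarrival: "(\<Sum>i\<le>n. interarrival t i \<omega>) = t n \<omega>"
  by (induction n) (simp_all add: interarrival_def)

lemma interarrival_sum: "interarrival (\<lambda>k \<omega>. \<Sum>j\<le>k. f j \<omega>) k \<omega> = f k \<omega>"
  by (cases k) (simp_all add: interarrival_def)

lemma measurable_interarrival:
  assumes [measurable]: "\<And>n. t n \<in> borel_measurable M"
  shows "interarrival t n \<in> borel_measurable M"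
  unfolding interarrival_def[abs_def] by (cases n) simp_all

text \<open>Independence says that the joint law is the product of the marginal laws, and an almost
  sure modification changes neither side.\<close>

lemma (in prob_space) indep_vars_cong_AE:
  assumes X: "indep_vars M' X I" and Y: "\<And>i. i \<in> I \<Longrightarrow> Y i \<in> measurable M (M' i)"
    and I: "I \<noteq> {}" and eq: "AE \<omega> in M. \<forall>i\<in>I. X i \<omega> = Y i \<omega>"
  shows "indep_vars M' Y I"
proof -
  have X_meas: "X i \<in> measurable M (M' i)" if "i \<in> I" for i
    using X that by (auto simp: indep_vars_def)
  have "distr M (\<Pi>\<^sub>M i\<in>I. M' i) (\<lambda>\<omega>. \<lambda>i\<in>I. Y i \<omega>) = distr M (\<Pi>\<^sub>M i\<in>I. M' i) (\<lambda>\<omega>. \<lambda>i\<in>I. X i \<omega>)"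
    using eq X_meas Y
    by (intro distr_cong_AE measurable_restrict) (auto elim!: eventually_mono simp: restrict_def)
  also have "\<dots> = (\<Pi>\<^sub>M i\<in>I. distr M (M' i) (X i))"
    using indep_vars_iff_distr_eq_PiM'[OF I X_meas] X by simp
  also have "\<dots> = (\<Pi>\<^sub>M i\<in>I. distr M (M' i) (Y i))"
    using eq X_meas Y by (intro PiM_cong distr_cong_AE) (auto elim!: eventually_mono)
  finally show ?thesis
    using indep_vars_iff_distr_eq_PiM'[OF I Y] by simp
qed

section \<open>Thinning a renewal process on an arbitrary probability space\<close>

context bernoulli_thinning
begin

text \<open>The sequence \<open>Z\<close> of marked inter-arrival times has law \<open>S\<close>, so
  its gaps are i.i.d. by \<open>distr_gaps\<close>; almost surely their partial sums are the points
  labelled \<open>l\<close>.\<close>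

lemma renewal_process_thinning:
  assumes M: "prob_space M"
    and t: "points_of M N t"
    and indep_Y: "prob_space.indep_vars M (\<lambda>_. borel) (interarrival t) UNIV"
    and distr_Y: "\<And>n. distr M borel (interarrival t n) = D"
    and indep_X: "prob_space.indep_vars M (\<lambda>_. count_space UNIV) X UNIV"
    and prob_X: "\<And>n. measure M {\<omega> \<in> space M. X n \<omega> = l} = p"
    and indep: "indep_sequences M t X"
    and N': "AE \<omega> in M. N' \<omega> = {t n \<omega> | n. X n \<omega> = l}"
  shows "renewal_process M (distr S borel first_gap) N'"
proof -
  interpret Pr: prob_space M by (rule M)
  have t_meas [measurable]: "t n \<in> borel_measurable M" for n
    using t by (auto simp: points_of_def)
  have Y_meas [measurable]: "interarrival t n \<in> borel_measurable M" for n
    by (rule measurable_interarrival) simp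
  have X_meas [measurable]: "X n \<in> measurable M (count_space UNIV)" for n
    using indep_X by (auto simp: Pr.indep_vars_def)
  \<comment> \<open>Only whether the label equals \<open>l\<close> matters for \<open>N'\<close>;
    such Boolean marks are Bernoulli(\<open>p\<close>) for either component.\<close>
  define X' where "X' n \<omega> \<longleftrightarrow> X n \<omega> = l" for n \<omega>
  have X'_meas [measurable]: "X' n \<in> measurable M (count_space UNIV)" for n
    unfolding X'_def[abs_def] by measurable
  have indep_X': "Pr.indep_vars (\<lambda>_. count_space UNIV) X' UNIV"
    unfolding X'_def[abs_def] by (rule Pr.indep_vars_compose2[OF indep_X]) simp
  define Z where "Z \<omega> = (\<lambda>n. (interarrival t n \<omega>, X' n \<omega>))" for \<omega>

  have YX': "Pr.prob {\<omega>\<in>space M. (\<lambda>i. interarrival t i \<omega>) \<in> A \<and> (\<lambda>i. X' i \<omega>) \<in> B} =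
      Pr.prob {\<omega>\<in>space M. (\<lambda>i. interarrival t i \<omega>) \<in> A} * Pr.prob {\<omega>\<in>space M. (\<lambda>i. X' i \<omega>) \<in> B}"
    if A: "A \<in> sets (\<Pi>\<^sub>M i\<in>UNIV. borel)" and B: "B \<in> sets (\<Pi>\<^sub>M i\<in>UNIV. count_space UNIV)" for A B
  proof -
    \<comment> \<open>\<open>g\<close> applies \<open>interarrival\<close> to the coordinate
      process, so the inter-arrival times are a measurable function of the path of \<open>t\<close>.
      With \<open>h\<close> doing the same for the marks, both events lie in the sigma-algebras that
      \<open>indep_sequences\<close> declares independent.\<close>
    define g :: "(nat \<Rightarrow> real) \<Rightarrow> nat \<Rightarrow> real" where "g \<tau> = (\<lambda>n. interarrival (\<lambda>n \<tau>. \<tau> n) n \<tau>)" for \<tau>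
    define h where "h x = (\<lambda>n. x n = l)" for x :: "nat \<Rightarrow> nat"
    have g_meas: "g \<in> measurable (\<Pi>\<^sub>M i\<in>UNIV. borel) (\<Pi>\<^sub>M i\<in>UNIV. borel)"
      unfolding g_def[abs_def] by (intro measurable_PiM_UNIV measurable_interarrival) measurable
    have gA: "g -` A \<in> sets (\<Pi>\<^sub>M i\<in>UNIV. borel)"
      using measurable_sets[OF g_meas A] by (simp add: space_PiM)
    have h_meas: "h \<in> measurable (\<Pi>\<^sub>M i\<in>UNIV. count_space UNIV) (\<Pi>\<^sub>M i\<in>UNIV. count_space UNIV)"
      unfolding h_def[abs_def] by (intro measurable_PiM_UNIV) measurable
    have hB: "h -` B \<in> sets (\<Pi>\<^sub>M i\<in>UNIV. count_space UNIV)"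
      using measurable_sets[OF h_meas B] by (simp add: space_PiM)
    have g: "(\<lambda>n. interarrival t n \<omega>) = g (\<lambda>n. t n \<omega>)" for \<omega>
      by (auto simp: g_def interarrival_def fun_eq_iff split: nat.split)
    have a: "{\<omega>\<in>space M. (\<lambda>i. interarrival t i \<omega>) \<in> A} = (\<lambda>\<omega> n. t n \<omega>) -` (g -` A) \<inter> space M"
      by (auto simp: g)
    have b: "{\<omega>\<in>space M. (\<lambda>i. X' i \<omega>) \<in> B} = (\<lambda>\<omega> n. X n \<omega>) -` (h -` B) \<inter> space M"
      by (auto simp: h_def X'_def)
    have "Pr.prob ({\<omega>\<in>space M. (\<lambda>i. interarrival t i \<omega>) \<in> A} \<inter> {\<omega>\<in>space M. (\<lambda>i. X' i \<omega>) \<in> B}) =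
        Pr.prob {\<omega>\<in>space M. (\<lambda>i. interarrival t i \<omega>) \<in> A} * Pr.prob {\<omega>\<in>space M. (\<lambda>i. X' i \<omega>) \<in> B}"
      unfolding a b
      using indep[unfolded indep_sequences_def] in_vimage_algebra[OF gA] in_vimage_algebra[OF hB]
      by (rule Pr.indep_setD)
    then show ?thesis
      by (simp add: Collect_conj_eq[symmetric] Int_def conj_assoc conj_left_commute)
  qed

  have distr_X': "distr M (count_space UNIV) (X' n) = measure_pmf (bernoulli_pmf p)" for n
  proof (rule measure_eqI_countable[where A=UNIV])
    fix b :: bool
    have "emeasure (distr M (count_space UNIV) (X' n)) {b} = ennreal (Pr.prob {\<omega>\<in>space M. X' n \<omega> = b})"
      by (subst emeasure_distr) (auto simp: Pr.emeasure_eq_measure vimage_def intro!: arg_cong[where f=Pr.prob])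
    also have "Pr.prob {\<omega>\<in>space M. X' n \<omega> = b} = (if b then p else 1 - p)"
      using prob_X[of n] Pr.prob_neg[of "X' n"] by (auto simp: X'_def)
    finally show "emeasure (distr M (count_space UNIV) (X' n)) {b} = emeasure (measure_pmf (bernoulli_pmf p)) {b}"
      using p_pos p_less_1 by (cases b) (simp_all add: emeasure_pmf_single)
  qed simp_all

  have sets_L: "sets L = sets (borel \<Otimes>\<^sub>M count_space UNIV)"
    by (rule sets_pair_measure_cong) (simp_all add: sets_D)
  have "(\<lambda>\<omega>. (interarrival t n \<omega>, X' n \<omega>)) \<in> measurable M L" for n
    unfolding measurable_cong_sets[OF refl sets_L] by (intro measurable_Pair Y_meas X'_meas)
  then have Z_meas [measurable]: "Z \<in> measurable M S"
    unfolding Z_def[abs_def] by (rule measurable_PiM_UNIV)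
  \<comment> \<open>The pairs are independent, so the joint law is a product, and each factor is the
    product of \<open>D\<close> and Bernoulli(\<open>p\<close>), that is \<open>L\<close>.\<close>
  have distr_Z: "distr M S Z = S"
  proof -
    have "distr M S Z = distr M (\<Pi>\<^sub>M n\<in>UNIV. borel \<Otimes>\<^sub>M count_space UNIV)
        (\<lambda>\<omega>. \<lambda>n\<in>UNIV. (interarrival t n \<omega>, X' n \<omega>))"
      by (intro distr_cong sets_PiM_cong sets_L) (simp_all add: Z_def restrict_UNIV)
    also have "\<dots> = (\<Pi>\<^sub>M n\<in>UNIV. distr M (borel \<Otimes>\<^sub>M count_space UNIV) (\<lambda>\<omega>. (interarrival t n \<omega>, X' n \<omega>)))"
    proof (rule iffD1[OF Pr.indep_vars_iff_distr_eq_PiM'])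
      show "Pr.indep_vars (\<lambda>_. borel \<Otimes>\<^sub>M count_space UNIV) (\<lambda>n \<omega>. (interarrival t n \<omega>, X' n \<omega>)) UNIV"
        by (rule Pr.indep_vars_Pair[OF indep_Y indep_X' YX'])
    qed (simp, intro measurable_Pair Y_meas X'_meas)
    also have "\<dots> = S"
      by (subst Pr.distr_Pair_eq[OF indep_Y indep_X' YX']) (simp_all only: distr_Y distr_X')
    finally show ?thesis .
  qed

  txt \<open>
    Summing the gaps, instead of selecting points of the original process, makes \<open>T\<close> measurable
    and its inter-arrival times equal to the gaps also on the null set where only finitely many
    points are kept.
  \<close>
  define G where "G k \<omega> = gap k (Z \<omega>)" for k \<omega>
  define T where "T k \<omega> = (\<Sum>j\<le>k. G j \<omega>)" for k \<omega>
  have G_meas [measurable]: "G k \<in> borel_measurable M" for k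
    unfolding G_def[abs_def] by measurable
  have interarrival_T: "interarrival T = G"
    unfolding T_def[abs_def] by (simp add: interarrival_sum fun_eq_iff)
  interpret F: prob_space "distr S borel first_gap"
    by (rule P.prob_space_distr) measurable
  have gaps_meas: "(\<lambda>\<omega> k. gap k \<omega>) \<in> measurable S (\<Pi>\<^sub>M k\<in>UNIV. borel)"
    by (rule measurable_PiM_UNIV) measurable
  have distr_G: "distr M (\<Pi>\<^sub>M k\<in>UNIV. borel) (\<lambda>\<omega> k. G k \<omega>) = (\<Pi>\<^sub>M k\<in>UNIV. distr S borel first_gap)"
  proof -
    have "distr M (\<Pi>\<^sub>M k\<in>UNIV. borel) (\<lambda>\<omega> k. G k \<omega>) =
        distr (distr M S Z) (\<Pi>\<^sub>M k\<in>UNIV. borel) (\<lambda>\<omega> k. gap k \<omega>)"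
      using gaps_meas by (simp add: distr_distr G_def comp_def)
    then show ?thesis
      by (simp only: distr_Z distr_gaps)
  qed
  have distr_G1: "distr M borel (G k) = distr S borel first_gap" for k
  proof -
    have "distr M borel (G k) = distr (distr M (\<Pi>\<^sub>M k\<in>UNIV. borel) (\<lambda>\<omega> k. G k \<omega>)) borel (\<lambda>x. x k)"
      by (subst distr_distr) (auto simp: comp_def intro!: measurable_PiM_UNIV)
    also have "\<dots> = distr (\<Pi>\<^sub>M k\<in>(UNIV::nat set). distr S borel first_gap) (distr S borel first_gap) (\<lambda>x. x k)"
      unfolding distr_G by (intro distr_cong) auto
    also have "\<dots> = distr S borel first_gap"
      by (rule distr_PiM_component) (auto intro: F.prob_space_axioms)
    finally show ?thesis .
  qed
  have "Pr.indep_vars (\<lambda>_. borel) G UNIV"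
    by (subst Pr.indep_vars_iff_distr_eq_PiM') (auto simp: restrict_UNIV distr_G distr_G1)
  moreover have "points_of M N' T"
    unfolding points_of_def
  proof (intro conjI allI)
    show "T n \<in> borel_measurable M" for n
      unfolding T_def[abs_def] by measurable
    \<comment> \<open>The almost sure statement under \<open>S\<close> is pulled back along
      \<open>Z\<close>.\<close>
    have "AE \<omega> in M. infinite {n. snd (Z \<omega> n)}"
      by (rule AE_distrD[OF Z_meas]) (simp only: distr_Z AE_infinite_success)
    moreover have "AE \<omega> in M. 0 < t 0 \<omega> \<and> strict_mono (\<lambda>n. t n \<omega>) \<and> filterlim (\<lambda>n. t n \<omega>) at_top sequentially"
      using t unfolding points_of_def by (auto elim: eventually_mono)
    ultimately show "AE \<omega> in M. 0 < T 0 \<omega> \<and> strict_mono (\<lambda>n. T n \<omega>) \<and>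
        filterlim (\<lambda>n. T n \<omega>) at_top sequentially \<and> N' \<omega> = range (\<lambda>n. T n \<omega>)"
      using N'
    proof eventually_elim
      case (elim \<omega>)
      define e where "e = enumerate {n. X n \<omega> = l}"
      have snd_Z: "{n. snd (Z \<omega> n)} = {n. X n \<omega> = l}"
        by (simp add: Z_def X'_def)
      \<comment> \<open>By \<open>sum_gap\<close> the sum of the gaps is a sum of inter-arrival
        times up to index \<open>e k\<close>, which telescopes to the original point with that
        index.\<close>
      have T: "T k \<omega> = t (e k) \<omega>" for k
        using sum_gap[OF elim(1), of k]
        by (simp add: T_def G_def snd_Z e_def) (simp add: Z_def sum_interarrival)
      have e: "strict_mono e" "range e = {n. X n \<omega> = l}"
        using elim(1) by (auto simp: snd_Z e_def strict_mono_enumerate range_enumerate)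
      have "t 0 \<omega> \<le> t (e 0) \<omega>"
        using elim(2) by (intro monoD[OF strict_mono_mono, of "\<lambda>n. t n \<omega>"]) auto
      moreover have "strict_mono (\<lambda>n. t (e n) \<omega>)"
        using elim(2) e by (auto simp: strict_mono_def)
      moreover have "filterlim (\<lambda>n. t (e n) \<omega>) at_top sequentially"
        using elim(2) by (intro filterlim_compose[OF _ filterlim_subseq[OF e(1)]]) auto
      moreover have "N' \<omega> = range (\<lambda>n. t (e n) \<omega>)"
      proof -
        have "N' \<omega> = (\<lambda>n. t n \<omega>) ` range e"
          using elim(3) unfolding e(2) by auto
        then show ?thesis by (simp add: image_image)
      qed
      ultimately show ?case
        using elim(2) by (simp add: T)
    qed
  qed
  ultimately show ?thesis
    unfolding renewal_process_def by (intro exI[of _ T]) (simp add: interarrival_T distr_G1)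
qed

end

section \<open>Mittag-Leffler inter-arrival times and the change of scale\<close>

lemma mittag_leffler_thinning:
  assumes M: "prob_space M"
    and p: "0 < p" "p < 1" and \<alpha>: "0 < \<alpha>"
    and mittag: "mittag_leffler \<alpha> \<mu>"
    and N: "renewal_process M \<mu> N"
    and t: "points_of M N t"
    and indep_X: "prob_space.indep_vars M (\<lambda>_. count_space UNIV) X UNIV"
    and prob_X: "\<And>n. measure M {\<omega> \<in> space M. X n \<omega> = l} = p"
    and indep: "indep_sequences M t X"
    and N': "AE \<omega> in M. N' \<omega> = {t n \<omega> | n. X n \<omega> = l}"
  shows "\<exists>c>0. \<exists>\<nu>. mittag_leffler \<alpha> \<nu> \<and> renewal_process M (distr \<nu> borel (\<lambda>x. c * x)) N'"
proof -
  interpret Pr: prob_space M by (rule M)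
  interpret bernoulli_thinning \<mu> p
    using mittag p by (simp add: bernoulli_thinning_def mittag_leffler_def)
  have pos: "AE x in \<mu>. 0 < x"
    and laplace: "\<And>s. 0 \<le> s \<Longrightarrow> (\<integral>x. exp (- s * x) \<partial>\<mu>) = 1 / (1 + s powr \<alpha>)"
    using mittag unfolding mittag_leffler_def by blast+
  obtain t' where t': "points_of M N t'"
    and indep_Y': "Pr.indep_vars (\<lambda>_. borel) (interarrival t') UNIV"
    and distr_Y': "\<And>n. distr M borel (interarrival t' n) = \<mu>"
    using N unfolding renewal_process_def by blast
  have Y_meas: "interarrival t n \<in> borel_measurable M" "interarrival t' n \<in> borel_measurable M" for n
    using t t' by (auto simp: points_of_def intro: measurable_interarrival)
  \<comment> \<open>The i.i.d. property is known for the enumeration \<open>t'\<close> obtained from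
    \<open>N\<close>, while the marks belong to \<open>t\<close>; the two agree almost
    surely.\<close>
  have Y_eq: "AE \<omega> in M. \<forall>n. interarrival t' n \<omega> = interarrival t n \<omega>"
    using AE_points_of_unique[OF t' t]
    by eventually_elim (simp add: interarrival_def split: nat.split)
  have "Pr.indep_vars (\<lambda>_. borel) (interarrival t) UNIV"
    using Y_eq Y_meas by (intro Pr.indep_vars_cong_AE[OF indep_Y']) auto
  moreover have "distr M borel (interarrival t n) = \<mu>" for n
    unfolding distr_Y'[of n, symmetric]
    using Y_eq Y_meas by (intro distr_cong_AE) (auto elim!: eventually_mono)
  ultimately have renewal: "renewal_process M (distr S borel first_gap) N'"
    by (rule renewal_process_thinning[OF M t _ _ indep_X prob_X indep N'])

  \<comment> \<open>This choice gives \<open>c powr \<alpha> = 1 / p\<close>, so dividing a gap by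
    \<open>c\<close> replaces \<open>s powr \<alpha>\<close> by \<open>p * s powr \<alpha>\<close>
    and cancels the factor \<open>1 / p\<close> in the transform of the gap.\<close>
  define c where "c = p powr (- 1 / \<alpha>)"
  have c: "0 < c" using p by (simp add: c_def)
  \<comment> \<open>Taking for \<open>\<nu>\<close> the law of the rescaled gap reduces the claim to
    computing its transform; multiplying by \<open>c\<close> recovers the law of the gap
    directly.\<close>
  define \<nu> where "\<nu> = distr S borel (\<lambda>\<omega>. first_gap \<omega> / c)"
  have "mittag_leffler \<alpha> \<nu>"
    unfolding mittag_leffler_def
  proof (intro conjI allI impI)
    show "prob_space \<nu>"
      unfolding \<nu>_def by (rule P.prob_space_distr) measurable
    show "AE x in \<nu>. 0 < x"
      unfolding \<nu>_def using AE_first_gap_pos[OF pos] c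
      by (subst AE_distr_iff) (auto elim!: eventually_mono)
    fix s :: real assume s: "0 \<le> s"
    have "(s / c) powr \<alpha> = p * s powr \<alpha>"
      using s c p \<alpha> by (simp add: powr_divide powr_mult c_def powr_powr powr_minus field_simps)
    then have "(\<integral>\<omega>. exp (- (s / c) * first_gap \<omega>) \<partial>S) =
        p * (1 / (1 + p * s powr \<alpha>)) / (1 - (1 - p) * (1 / (1 + p * s powr \<alpha>)))"
      using laplace[of "s / c"] s c by (intro laplace_first_gap[OF pos]) auto
    also have "\<dots> = 1 / (1 + s powr \<alpha>)"
    proof -
      have "0 < 1 + p * s powr \<alpha>" "0 < 1 + s powr \<alpha>"
        using p by (simp_all add: add_pos_nonneg)
      then have "1 - (1 - p) * (1 / (1 + p * s powr \<alpha>)) = p * (1 + s powr \<alpha>) / (1 + p * s powr \<alpha>)"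
        by (simp add: field_simps)
      then show ?thesis
        using p \<open>0 < 1 + p * s powr \<alpha>\<close> by simp
    qed
    finally show "(\<integral>x. exp (- s * x) \<partial>\<nu>) = 1 / (1 + s powr \<alpha>)"
      unfolding \<nu>_def by (subst integral_distr) (auto simp: field_simps)
  qed (simp add: \<nu>_def)
  moreover have "distr \<nu> borel (\<lambda>x. c * x) = distr S borel first_gap"
    unfolding \<nu>_def using c by (subst distr_distr) (auto simp: comp_def)
  ultimately show ?thesis
    using c renewal by (intro exI[of _ c] exI[of _ \<nu>]) auto
qed

theorem mainTheorem2:
  fixes M :: "'a measure"
    and \<alpha> p :: real
    and \<mu> :: "real measure"
    and N N1 N2 :: "'a \<Rightarrow> real set"
    and t :: "nat \<Rightarrow> 'a \<Rightarrow> real"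
    and X :: "nat \<Rightarrow> 'a \<Rightarrow> nat"
  assumes "prob_space M"
    and "0 < \<alpha>" "\<alpha> \<le> 1"
    and "0 < p" "p < 1"
    and "mittag_leffler \<alpha> \<mu>"
    and "renewal_process M \<mu> N"
    and "indicator_process M t N N1 N2 X"
    and "bernoulli_process M p X"
    and "indep_sequences M t X"
  shows "(\<exists>c>0. \<exists>\<nu>. mittag_leffler \<alpha> \<nu> \<and>
            renewal_process M (distr \<nu> borel (\<lambda>x. c * x)) N1) \<and>
         (\<exists>c>0. \<exists>\<nu>. mittag_leffler \<alpha> \<nu> \<and>
            renewal_process M (distr \<nu> borel (\<lambda>x. c * x)) N2)"
proof -
  have t: "points_of M N t"
    using assms(8) by (simp add: indicator_process_def)
  have "AE \<omega> in M. N \<omega> = range (\<lambda>n. t n \<omega>)"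
    using t unfolding points_of_def by (auto elim: eventually_mono)
  moreover have "AE \<omega> in M. N \<omega> = N1 \<omega> \<union> N2 \<omega> \<and>
      (\<forall>n. (X n \<omega> = 1 \<longleftrightarrow> t n \<omega> \<in> N1 \<omega>) \<and> (X n \<omega> = 2 \<longleftrightarrow> t n \<omega> \<in> N2 \<omega>))"
    using assms(8) unfolding indicator_process_def by (auto elim: eventually_mono)
  \<comment> \<open>Each point of either component is a point of \<open>N\<close>, hence some
    \<open>t n\<close>, and its label tells which component contains it.\<close>
  ultimately have "AE \<omega> in M. N1 \<omega> = {t n \<omega> | n. X n \<omega> = 1} \<and> N2 \<omega> = {t n \<omega> | n. X n \<omega> = 2}"
  proof eventually_elim
    case (elim \<omega>)
    then have "\<exists>n. x = t n \<omega>" if "x \<in> N1 \<omega> \<union> N2 \<omega>" for x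
      using that by blast
    with elim show ?case by auto
  qed
  then have N1: "AE \<omega> in M. N1 \<omega> = {t n \<omega> | n. X n \<omega> = 1}"
    and N2: "AE \<omega> in M. N2 \<omega> = {t n \<omega> | n. X n \<omega> = 2}"
    by (auto elim: eventually_mono)
  have X: "prob_space.indep_vars M (\<lambda>_. count_space UNIV) X UNIV"
    and X1: "\<And>n. measure M {\<omega> \<in> space M. X n \<omega> = 1} = p"
    and X2: "\<And>n. measure M {\<omega> \<in> space M. X n \<omega> = 2} = 1 - p"
    using assms(9) by (simp_all add: bernoulli_process_def)
  show ?thesis
  proof
    show "\<exists>c>0. \<exists>\<nu>. mittag_leffler \<alpha> \<nu> \<and> renewal_process M (distr \<nu> borel (\<lambda>x. c * x)) N1"
      by (rule mittag_leffler_thinning[OF assms(1,4,5,2,6,7) t X X1 assms(10) N1])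
    show "\<exists>c>0. \<exists>\<nu>. mittag_leffler \<alpha> \<nu> \<and> renewal_process M (distr \<nu> borel (\<lambda>x. c * x)) N2"
    \<comment> \<open>For the second component a success is the label 2, so the success probability,
      and with it the scale, is that of \<open>1 - p\<close>.\<close>
    proof (rule mittag_leffler_thinning[OF assms(1) _ _ assms(2,6,7) t X X2 assms(10) N2])
      show "0 < 1 - p" "1 - p < 1"
        using assms(4,5) by simp_all
    qed
  qed
qed

end
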